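(* In the fast-slow skew-product setting described in the context, let $\mathcal L\subset\mathsf{Att}(\psi)\ltimes\Pi_0[\mathsf{Att}]$ be a finite meet-semilattice, for each $u\in\mathcal L$ let $K(u)\in\mathsf{SANbhd}(\Phi_0)$ be a chosen singular attracting neighborhood associated with $u$, with threshold $\epsilon_1(u)>0$, let $\epsilon_{\mathcal L}:=\min_{u\in\mathcal L}\epsilon_1(u)>0$, let $\mathcal K(\mathcal L)$ be the singular attracting neighborhood lattice generated by $\mathcal L$, and for $0<\epsilon\le\epsilon_{\mathcal L}$ set $h_\epsilon(u):=\mathrm{Inv}(K(u),\Phi_\epsilon)$ for $u\in\mathcal L$ and $\mathcal A_\epsilon(\mathcal L):=\{\mathrm{Inv}(N,\Phi_\epsilon)\mid N\in\mathcal K(\mathcal L)\}$. Then for every $0<\epsilon\le\epsilon_{\mathcal L}$, $$\mathcal A_\epsilon(\mathcal L)=\big\langle h_\epsilon(\mathcal L)\big\rangle_{\mathrm{Lat}}\subset\mathsf{Att}(\Phi_\epsilon),$$ that is, the attractor lattice obtained from $\mathcal K(\mathcal L)$ is exactly the finite distributive sublattice generated by the meet-image $h_\epsilon(\mathcal L)$.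
   Context: General notions. For a continuous semiflow $\theta\colon\mathbb{R}^+\times Z\to Z$ on a compact metric space $Z$ (not assumed injective or surjective): $S$ is invariant if $\theta(t,S)=S$ for all $t\ge0$; $\mathrm{Inv}(U,\theta)$ is the union of all invariant subsets of $U$; $\omega_\theta(U)=\bigcap_{t\ge0}\mathrm{cl}(\theta([t,\infty),U))$; $U$ is an attracting neighborhood if for some $\tau>0$, $\theta(t,\mathrm{cl}\,U)\subset\mathrm{int}\,U$ for all $t\ge\tau$, and an attracting block if this inclusion holds for all $t>0$; attractors are the sets $\omega_\theta(U)=\mathrm{Inv}(U,\theta)$ with $U$ an attracting neighborhood; $\mathsf{Att}(\theta)$ is the bounded distributive lattice of attractors with $\vee=\cup$, $A\wedge B=\omega_\theta(A\cap B)=\mathrm{Inv}(A\cap B,\theta)$. Bounded distributive lattices have maximal and minimal elements, and homomorphisms between them preserve these elements. Setting. $X,Y$ are compact metric spaces. For $\epsilon\ge0$, $\Phi_\epsilon\colon\mathbb{R}^+\times X\times Y\to X\times Y$, $\Phi_\epsilon(t,x,y)=(\phi_\epsilon(t,x,y),\psi_\epsilon(t,y))$, is a skew-product flow, where $\psi_\epsilon(t,y)=\psi(\epsilon t,y)$ is the flow of $\dot y=\epsilon g(y)$, and $\Phi_\epsilon\to\Phi_0$ uniformly on compact sets as $\epsilon\to0$. Here $\phi_0\colon\mathbb{R}^+\times X\times Y\to X$ is the parametrized flow of $\dot x=f(x,y)$ with $y$ a fixed parameter, so $\Phi_0(t,x,y)=(\phi_0(t,x,y),y)$; write $\phi_0^y=\phi_0(\cdot,\cdot,y)$,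 a semiflow on $X$. For all $\epsilon>0$ the $\psi_\epsilon$ have the same attractors as $\psi$. Sections and cascade. For open $U\subset Y$, $\Pi_0[\mathsf{Att}](U)$ is the set of (continuous) sections over $U$: assignments $y\mapsto\sigma(y)\in\mathsf{Att}(\phi_0^y)$ such that each $y\in U$ has a neighborhood $V\subset U$ and a set $N\subset X$ that is an attracting neighborhood for $\phi_0^{y'}$ with $\omega_{\phi_0^{y'}}(N)=\sigma(y')$ for all $y'\in V$. The cascade $\mathsf{Att}(\psi)\ltimes\Pi_0[\mathsf{Att}]$ is the set of pairs $(A,\sigma)$ with $A\in\mathsf{Att}(\psi)$ and $\sigma$ the germ at $A$ of a section over some open $U\supset A$ with $\omega_\psi(U)=A$ (sections agreeing on some open attracting neighborhood of $A$ are identified). It is a meet-semilattice under $(A,\sigma)\wedge(B,\tau)=(A\cap B,\sigma|_{A\cap B}\wedge\tau|_{A\cap B})$, with $(\sigma\wedge\tau)(y)=\sigma(y)\wedge\tau(y)$ in $\mathsf{Att}(\phi_0^y)$. Singular attracting neighborhoods. A set $K\subset X\times Y$ is a singular attracting neighborhood if $K$ is not an attracting neighborhood for $\Phi_0$, but there exists $\epsilon_K>0$ such that $K$ is an attracting neighborhood for $\Phi_\epsilon$ for all $\epsilon\in(0,\epsilon_K]$. $\mathsf{SANbhd}(\Phi_0)$ is the collection of singular attracting neighborhoods, regarded as a bounded distributive lattice under $\wedge=\cap$, $\vee=\cup$. To $u=(A,\sigma)$, with $\sigma$ defined on $U$, a compact singular attracting neighborhood $K(u)$ is associated as follows: choose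 finitely many $y_i\in A$, open $V_{y_i}\ni y_i$ with $\mathrm{cl}(V_{y_i})\subset U$ and $A\subset\bigcup_iV_{y_i}$, compact $N_i\subset X$ and $T_i>0$ such that for all $y'\in\mathrm{cl}(V_{y_i})$: $\phi_0(t,N_i,y')\subset\mathrm{int}(N_i)$ for $t\ge T_i$ and $\omega_{\phi_0^{y'}}(N_i)=\sigma(y')$; choose a compact attracting block $W\subset\bigcup_iV_{y_i}$ for $\psi$ with $\omega_\psi(W)=A$ and $W=\mathrm{cl}(\mathrm{int}\,W)$; put $V_i=V_{y_i}\cap\mathrm{int}\,W$ and $K(u)=\mathrm{cl}\big(\bigcup_iN_i\times V_i\big)$. The threshold $\epsilon_1(u)>0$ is such that $K(u)$ is an attracting neighborhood for $\Phi_\epsilon$ for all $0<\epsilon\le\epsilon_1(u)$. Generated lattices. $\mathcal K(\mathcal L)$ is the smallest sublattice of $\mathsf{SANbhd}(\Phi_0)$ containing $\{K(u)\mid u\in\mathcal L\}$, described explicitly as $\big\{\bigcup_{j=1}^m\bigcap_{u\in I_j}K(u)\mid m\ge1,\ I_j\subset\mathcal L\text{ finite}\big\}\cup\{\emptyset\}$. For $S\subset\mathsf{Att}(\Phi_\epsilon)$, $\langle S\rangle_{\mathrm{Lat}}$ is the sublattice of $\mathsf{Att}(\Phi_\epsilon)$ generated by $S$, i.e. the smallest sublattice containing $S$, described explicitly as $\big\{\bigvee_{i=1}^k\bigwedge_{j=1}^{m_i}s_{ij}\mid s_{ij}\in S,\ k,m_i\in\mathbb{N}\big\}$. *)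

theory Defs
  imports "HOL-Analysis.Analysis"
begin

section \<open>Semiflows and attractors\<close>

text \<open>A semiflow has type \<open>real \<Rightarrow> 'z \<Rightarrow> 'z\<close>; only its values at times \<open>t \<ge> 0\<close> are ever used.\<close>

definition semiflow :: "(real \<Rightarrow> 'z::metric_space \<Rightarrow> 'z) \<Rightarrow> bool" where
  "semiflow \<theta> \<longleftrightarrow>
     continuous_on ({0..} \<times> UNIV) (\<lambda>(t, z). \<theta> t z) \<and>
     (\<forall>z. \<theta> 0 z = z) \<and>
     (\<forall>s\<ge>0. \<forall>t\<ge>0. \<forall>z. \<theta> (s + t) z = \<theta> s (\<theta> t z))"

definition invariant :: "(real \<Rightarrow> 'z \<Rightarrow> 'z) \<Rightarrow> 'z set \<Rightarrow> bool" where
  "invariant \<theta> S \<longleftrightarrow> (\<forall>t\<ge>0. \<theta> t ` S = S)"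

definition Inv :: "(real \<Rightarrow> 'z \<Rightarrow> 'z) \<Rightarrow> 'z set \<Rightarrow> 'z set" where
  "Inv \<theta> U = \<Union>{S. S \<subseteq> U \<and> invariant \<theta> S}"

definition omega :: "(real \<Rightarrow> 'z::metric_space \<Rightarrow> 'z) \<Rightarrow> 'z set \<Rightarrow> 'z set" where
  "omega \<theta> U = (\<Inter>t\<in>{0..}. closure (\<Union>s\<in>{t..}. \<theta> s ` U))"

definition attracting_nbhd :: "(real \<Rightarrow> 'z::metric_space \<Rightarrow> 'z) \<Rightarrow> 'z set \<Rightarrow> bool" where
  "attracting_nbhd \<theta> U \<longleftrightarrow> (\<exists>\<tau>>0. \<forall>t\<ge>\<tau>. \<theta> t ` closure U \<subseteq> interior U)"

definition attracting_block :: "(real \<Rightarrow> 'z::metric_space \<Rightarrow> 'z) \<Rightarrow> 'z set \<Rightarrow> bool" where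
  "attracting_block \<theta> U \<longleftrightarrow> (\<forall>t>0. \<theta> t ` closure U \<subseteq> interior U)"

definition Att :: "(real \<Rightarrow> 'z::metric_space \<Rightarrow> 'z) \<Rightarrow> 'z set set" where
  "Att \<theta> = {omega \<theta> U | U. attracting_nbhd \<theta> U}"

text \<open>The join of \<^term>\<open>Att \<theta>\<close> is union, its least element is \<^term>\<open>{}\<close> and its greatest element
  is \<^term>\<open>omega \<theta> UNIV\<close>.\<close>

definition att_meet :: "(real \<Rightarrow> 'z::metric_space \<Rightarrow> 'z) \<Rightarrow> 'z set \<Rightarrow> 'z set \<Rightarrow> 'z set" where
  "att_meet \<theta> A B = omega \<theta> (A \<inter> B)"


section \<open>Generated sublattices\<close>

text \<open>Sublattices of a bounded lattice (carrier \<open>C\<close>) contain its least and greatest element.\<close>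

definition bounded_sublattice ::
  "'a set \<Rightarrow> 'a \<Rightarrow> 'a \<Rightarrow> ('a \<Rightarrow> 'a \<Rightarrow> 'a) \<Rightarrow> ('a \<Rightarrow> 'a \<Rightarrow> 'a) \<Rightarrow> 'a set \<Rightarrow> bool" where
  "bounded_sublattice C least greatest meet join M \<longleftrightarrow>
     M \<subseteq> C \<and> least \<in> M \<and> greatest \<in> M \<and>
     (\<forall>a\<in>M. \<forall>b\<in>M. meet a b \<in> M \<and> join a b \<in> M)"

definition generated_sublattice ::
  "'a set \<Rightarrow> 'a \<Rightarrow> 'a \<Rightarrow> ('a \<Rightarrow> 'a \<Rightarrow> 'a) \<Rightarrow> ('a \<Rightarrow> 'a \<Rightarrow> 'a) \<Rightarrow> 'a set \<Rightarrow> 'a set" where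
  "generated_sublattice C least greatest meet join S =
     \<Inter>{M. bounded_sublattice C least greatest meet join M \<and> S \<subseteq> M}"

definition att_sublattice :: "(real \<Rightarrow> 'z::metric_space \<Rightarrow> 'z) \<Rightarrow> 'z set set \<Rightarrow> bool" where
  "att_sublattice \<theta> =
     bounded_sublattice (Att \<theta>) {} (omega \<theta> UNIV) (att_meet \<theta>) (\<union>)"

definition att_generated :: "(real \<Rightarrow> 'z::metric_space \<Rightarrow> 'z) \<Rightarrow> 'z set set \<Rightarrow> 'z set set" where
  "att_generated \<theta> =
     generated_sublattice (Att \<theta>) {} (omega \<theta> UNIV) (att_meet \<theta>) (\<union>)"

text \<open>Taken in the powerset: the sets that are singular attracting neighborhoods
  in the literal sense of \<open>SANbhd\<close> below are not closed under intersection
  (for instance, \<^term>\<open>{}\<close> is attracting for every semiflow).\<close>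

definition set_generated :: "'z set set \<Rightarrow> 'z set set" where
  "set_generated = generated_sublattice UNIV {} UNIV (\<inter>) (\<union>)"

lemma generated_sublattice_least:
  "bounded_sublattice C l g m j M \<Longrightarrow> S \<subseteq> M \<Longrightarrow> generated_sublattice C l g m j S \<subseteq> M"
  by (auto simp: generated_sublattice_def)

lemma set_generated_sublattice:
  "bounded_sublattice UNIV {} UNIV (\<inter>) (\<union>) (set_generated S)" "S \<subseteq> set_generated S"
  by (auto simp: set_generated_def generated_sublattice_def bounded_sublattice_def)

lemma set_generated_family:
  "set_generated (K ` L) =
     {\<Union>T\<in>\<T>. \<Inter>u\<in>T. K u | \<T>. finite \<T> \<and> (\<forall>T\<in>\<T>. finite T \<and> T \<subseteq> L)}"
proof -
  define P where "P \<T> \<longleftrightarrow> finite \<T> \<and> (\<forall>T\<in>\<T>. finite T \<and> T \<subseteq> L)" for \<T>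
  define g where "g T = (\<Inter>u\<in>T. K u)" for T
  define R where "R = {\<Union>T\<in>\<T>. g T | \<T>. P \<T>}"
  let ?G = "set_generated (K ` L)"
  have RI: "k \<in> R" if "P \<T>" "k = (\<Union>T\<in>\<T>. g T)" for k \<T>
    unfolding R_def using that by (intro CollectI exI conjI)
  have un: "a \<union> b \<in> R" and int: "a \<inter> b \<in> R" if ab: "a \<in> R" "b \<in> R" for a b
  proof -
    obtain \<T> where T: "P \<T>" "a = (\<Union>T\<in>\<T>. g T)" using ab(1) unfolding R_def by (elim CollectE exE conjE)
    obtain \<T>' where T': "P \<T>'" "b = (\<Union>T\<in>\<T>'. g T)" using ab(2) unfolding R_def by (elim CollectE exE conjE)
    have "P (\<T> \<union> \<T>')" using T(1) T'(1) by (simp add: P_def ball_Un)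
    moreover have "a \<union> b = (\<Union>T\<in>\<T> \<union> \<T>'. g T)" unfolding T(2) T'(2) by (simp only: UN_Un)
    ultimately show "a \<union> b \<in> R" by (rule RI)
    let ?S = "(\<lambda>q. fst q \<union> snd q) ` (\<T> \<times> \<T>')"
    have "P ?S" using T(1) T'(1) by (simp add: P_def)
    moreover have "a \<inter> b = (\<Union>T\<in>?S. g T)"
    proof -
      have "g (T \<union> T') = g T \<inter> g T'" for T T' by (simp add: g_def INF_union)
      then have "(\<Union>T\<in>?S. g T) = (\<Union>q\<in>\<T> \<times> \<T>'. g (fst q) \<inter> g (snd q))" by simp
      also have "\<dots> = (\<Union>T\<in>\<T>. \<Union>T'\<in>\<T>'. g T \<inter> g T')" by (simp add: Sigma_def)
      also have "\<dots> = a \<inter> b" unfolding T(2) T'(2) by blast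
      finally show ?thesis ..
    qed
    ultimately show "a \<inter> b \<in> R" by (rule RI)
  qed
  have bounds: "{} \<in> R" "UNIV \<in> R"
    by (rule RI[of "{}"]; simp add: P_def) (rule RI[of "{{}}"]; simp add: P_def g_def)
  have KR: "K ` L \<subseteq> R"
  proof
    fix k assume "k \<in> K ` L"
    then obtain u where "u \<in> L" "k = K u" by blast
    then show "k \<in> R" by (intro RI[of "{{u}}"]) (simp_all add: P_def g_def)
  qed
  have "bounded_sublattice UNIV {} UNIV (\<inter>) (\<union>) R"
    by (simp add: bounded_sublattice_def bounds un int)
  then have "?G \<subseteq> R"
    unfolding set_generated_def using KR by (rule generated_sublattice_least)
  moreover have "R \<subseteq> ?G"
  proof -
    have bnd: "{} \<in> ?G" "UNIV \<in> ?G"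
      and Gint: "\<And>a b. a \<in> ?G \<Longrightarrow> b \<in> ?G \<Longrightarrow> a \<inter> b \<in> ?G"
      and Gun: "\<And>a b. a \<in> ?G \<Longrightarrow> b \<in> ?G \<Longrightarrow> a \<union> b \<in> ?G"
      using set_generated_sublattice(1)[of "K ` L"] by (simp_all add: bounded_sublattice_def)
    have KG: "K u \<in> ?G" if "u \<in> L" for u
      using set_generated_sublattice(2)[of "K ` L"] that by blast
    have g: "T \<subseteq> L \<Longrightarrow> g T \<in> ?G" if "finite T" for T
      using that by (induction T) (simp_all add: g_def bnd Gint KG)
    have "(\<forall>T\<in>\<T>. finite T \<and> T \<subseteq> L) \<Longrightarrow> (\<Union>T\<in>\<T>. g T) \<in> ?G" if "finite \<T>" for \<T>
      using that by (induction \<T>) (simp_all add: bnd Gun g)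
    then show ?thesis unfolding R_def P_def by blast
  qed
  ultimately show ?thesis unfolding R_def P_def g_def by (rule equalityI)
qed

lemma set_generated_explicit:
  "set_generated (K ` L) =
     {\<Union>j\<in>{1..m}. \<Inter>u\<in>I j. K u | (m::nat) I. m \<ge> 1 \<and> (\<forall>j\<in>{1..m}. finite (I j) \<and> I j \<subseteq> L)} \<union> {{}}"
  (is "_ = ?E")
proof
  show "?E \<subseteq> set_generated (K ` L)"
  proof
    fix k assume "k \<in> ?E"
    then consider "k = {}" | m and I :: "nat \<Rightarrow> _"
      where "k = (\<Union>j\<in>{1..m}. \<Inter>u\<in>I j. K u)" "\<forall>j\<in>{1..m}. finite (I j) \<and> I j \<subseteq> L"
      by auto
    then show "k \<in> set_generated (K ` L)"
    proof cases
      case 1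
      then show ?thesis
        using set_generated_sublattice(1)[of "K ` L"] by (simp add: bounded_sublattice_def)
    next
      case 2
      show ?thesis unfolding set_generated_family
        by (rule CollectI, rule exI[of _ "I ` {1..m}"]) (use 2 in auto)
    qed
  qed
  show "set_generated (K ` L) \<subseteq> ?E"
  proof
    fix k assume "k \<in> set_generated (K ` L)"
    then obtain \<T> where T: "k = (\<Union>T\<in>\<T>. \<Inter>u\<in>T. K u)" "finite \<T>" "\<forall>T\<in>\<T>. finite T \<and> T \<subseteq> L"
      unfolding set_generated_family by blast
    show "k \<in> ?E"
    proof (cases "\<T> = {}")
      case True
      then show ?thesis using T by simp
    next
      case False
      obtain I where I: "bij_betw I {1..card \<T>} \<T>"
        using ex_bij_betw_nat_finite_1[OF T(2)] by blast
      have img: "I ` {1..card \<T>} = \<T>" using I by (simp add: bij_betw_def)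
      have 1: "k = (\<Union>j\<in>{1..card \<T>}. \<Inter>u\<in>I j. K u)"
        using arg_cong[OF img, of "\<lambda>\<S>. \<Union>T\<in>\<S>. \<Inter>u\<in>T. K u"] T(1) by (simp add: image_image)
      have 2: "\<forall>j\<in>{1..card \<T>}. finite (I j) \<and> I j \<subseteq> L" using T(3) img by blast
      have 3: "1 \<le> card \<T>" using False T(2) by (simp add: Suc_le_eq card_gt_0_iff)
      show ?thesis
        by (rule UnI1, rule CollectI, rule exI[of _ "card \<T>"], rule exI[of _ I])
          (intro conjI 1 2 3)
    qed
  qed
qed


section \<open>Fast-slow skew products\<close>

definition skew ::
  "(real \<Rightarrow> real \<Rightarrow> 'x \<Rightarrow> 'y \<Rightarrow> 'x) \<Rightarrow> (real \<Rightarrow> 'y \<Rightarrow> 'y) \<Rightarrow> real \<Rightarrow> real \<Rightarrow> 'x \<times> 'y \<Rightarrow> 'x \<times> 'y" where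
  "skew \<phi> \<psi> \<epsilon> t = (\<lambda>(x, y). (\<phi> \<epsilon> t x y, \<psi> (\<epsilon> * t) y))"

definition fast_slow ::
  "(real \<Rightarrow> real \<Rightarrow> 'x::metric_space \<Rightarrow> 'y::metric_space \<Rightarrow> 'x) \<Rightarrow> (real \<Rightarrow> 'y \<Rightarrow> 'y) \<Rightarrow> bool" where
  "fast_slow \<phi> \<psi> \<longleftrightarrow>
     compact (UNIV :: 'x set) \<and> compact (UNIV :: 'y set) \<and>
     semiflow \<psi> \<and>
     (\<forall>\<epsilon>\<ge>0. semiflow (skew \<phi> \<psi> \<epsilon>)) \<and>
     (\<forall>C. compact C \<and> C \<subseteq> {0..} \<times> UNIV \<longrightarrow>
        uniform_limit C (\<lambda>\<epsilon> (t, z). skew \<phi> \<psi> \<epsilon> t z) (\<lambda>(t, z). skew \<phi> \<psi> 0 t z) (at_right 0))"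

text \<open>The standing remark that the rescaled flows have the same attractors is automatic.\<close>

lemma Att_rescale:
  fixes \<psi> :: "real \<Rightarrow> 'y::metric_space \<Rightarrow> 'y"
  assumes "\<epsilon> > 0"
  shows "Att (\<lambda>t. \<psi> (\<epsilon> * t)) = Att \<psi>"
proof -
  have nbhd: "attracting_nbhd (\<lambda>t. \<psi> (e * t)) U"
    if e: "e > 0" and nb: "attracting_nbhd \<psi> U" for e :: real and \<psi> :: "real \<Rightarrow> 'y \<Rightarrow> 'y" and U
  proof -
    obtain \<tau> where \<tau>: "\<tau> > 0" "\<And>t. t \<ge> \<tau> \<Longrightarrow> \<psi> t ` closure U \<subseteq> interior U"
      using nb unfolding attracting_nbhd_def by blast
    show ?thesis unfolding attracting_nbhd_def
      by (rule exI[of _ "\<tau> / e"]) (use \<tau> e in \<open>simp add: field_simps\<close>)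
  qed
  have om: "omega \<psi> U \<subseteq> omega (\<lambda>t. \<psi> (e * t)) U"
    if "e > 0" for e :: real and \<psi> :: "real \<Rightarrow> 'y \<Rightarrow> 'y" and U
  proof -
    have "omega \<psi> U \<subseteq> closure (\<Union>s\<in>{t..}. \<psi> (e * s) ` U)" if t: "t \<ge> 0" for t
    proof -
      have "(\<Union>s\<in>{e * t..}. \<psi> s ` U) \<subseteq> (\<Union>s\<in>{t..}. \<psi> (e * s) ` U)"
      proof (rule UN_least)
        fix s assume "s \<in> {e * t..}"
        then have "s / e \<in> {t..}" "e * (s / e) = s"
          using \<open>e > 0\<close> by (auto simp: field_simps)
        then show "\<psi> s ` U \<subseteq> (\<Union>s\<in>{t..}. \<psi> (e * s) ` U)" by (metis UN_upper)
      qed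
      then have "closure (\<Union>s\<in>{e * t..}. \<psi> s ` U) \<subseteq> closure (\<Union>s\<in>{t..}. \<psi> (e * s) ` U)"
        by (rule closure_mono)
      moreover have "e * t \<in> {0..}" using t \<open>e > 0\<close> by simp
      ultimately show ?thesis unfolding omega_def by blast
    qed
    then show ?thesis unfolding omega_def[of "\<lambda>t. \<psi> (e * t)"] by blast
  qed
  have undo: "(\<lambda>t. \<psi> (\<epsilon> * (inverse \<epsilon> * t))) = \<psi>"
    using assms by (simp add: mult.assoc[symmetric])
  have i: "inverse \<epsilon> > 0" using assms by simp
  have "attracting_nbhd (\<lambda>t. \<psi> (\<epsilon> * t)) U \<longleftrightarrow> attracting_nbhd \<psi> U" for U
    using nbhd[OF assms, of \<psi> U] nbhd[OF i, of "\<lambda>t. \<psi> (\<epsilon> * t)" U] unfolding undo by blast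
  moreover have "omega (\<lambda>t. \<psi> (\<epsilon> * t)) U = omega \<psi> U" for U
    using om[OF assms, of \<psi> U] om[OF i, of "\<lambda>t. \<psi> (\<epsilon> * t)" U] unfolding undo by blast
  ultimately show ?thesis by (simp add: Att_def)
qed

definition layer :: "(real \<Rightarrow> real \<Rightarrow> 'x \<Rightarrow> 'y \<Rightarrow> 'x) \<Rightarrow> 'y \<Rightarrow> real \<Rightarrow> 'x \<Rightarrow> 'x" where
  "layer \<phi> y t x = \<phi> 0 t x y"


section \<open>Sections and the cascade\<close>

text \<open>A section over \<open>U\<close> is a total function of which only the values on \<open>U\<close> matter.\<close>

definition att_section ::
  "(real \<Rightarrow> real \<Rightarrow> 'x::metric_space \<Rightarrow> 'y::metric_space \<Rightarrow> 'x) \<Rightarrow> 'y set \<Rightarrow> ('y \<Rightarrow> 'x set) \<Rightarrow> bool" where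
  "att_section \<phi> U \<sigma> \<longleftrightarrow>
     (\<forall>y\<in>U. \<sigma> y \<in> Att (layer \<phi> y)) \<and>
     (\<forall>y\<in>U. \<exists>V N. open V \<and> y \<in> V \<and> V \<subseteq> U \<and>
        (\<forall>y'\<in>V. attracting_nbhd (layer \<phi> y') N \<and> omega (layer \<phi> y') N = \<sigma> y'))"

definition sections_at ::
  "(real \<Rightarrow> real \<Rightarrow> 'x::metric_space \<Rightarrow> 'y::metric_space \<Rightarrow> 'x) \<Rightarrow> (real \<Rightarrow> 'y \<Rightarrow> 'y) \<Rightarrow> 'y set \<Rightarrow>
   ('y set \<times> ('y \<Rightarrow> 'x set)) set" where
  "sections_at \<phi> \<psi> A =
     {(U, \<sigma>). open U \<and> A \<subseteq> U \<and> omega \<psi> U = A \<and> att_section \<phi> U \<sigma>}"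

definition germ_rel ::
  "(real \<Rightarrow> real \<Rightarrow> 'x::metric_space \<Rightarrow> 'y::metric_space \<Rightarrow> 'x) \<Rightarrow> (real \<Rightarrow> 'y \<Rightarrow> 'y) \<Rightarrow> 'y set \<Rightarrow>
   (('y set \<times> ('y \<Rightarrow> 'x set)) \<times> ('y set \<times> ('y \<Rightarrow> 'x set))) set" where
  "germ_rel \<phi> \<psi> A =
     {((U, \<sigma>), (U', \<sigma>')). (U, \<sigma>) \<in> sections_at \<phi> \<psi> A \<and> (U', \<sigma>') \<in> sections_at \<phi> \<psi> A \<and>
        (\<exists>V. open V \<and> attracting_nbhd \<psi> V \<and> omega \<psi> V = A \<and> A \<subseteq> V \<and> V \<subseteq> U \<inter> U' \<and>
             (\<forall>y\<in>V. \<sigma> y = \<sigma>' y))}"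

type_synonym ('x, 'y) germ = "('y set \<times> ('y \<Rightarrow> 'x set)) set"

definition cascade ::
  "(real \<Rightarrow> real \<Rightarrow> 'x::metric_space \<Rightarrow> 'y::metric_space \<Rightarrow> 'x) \<Rightarrow> (real \<Rightarrow> 'y \<Rightarrow> 'y) \<Rightarrow>
   ('y set \<times> ('x, 'y) germ) set" where
  "cascade \<phi> \<psi> = (SIGMA A : Att \<psi>. sections_at \<phi> \<psi> A // germ_rel \<phi> \<psi> A)"

text \<open>The meet is defined on representatives and lifted to equivalence classes: a pair of
  representatives over \<open>U\<close> and \<open>U'\<close> contributes the class of the pointwise meet over \<open>U \<inter> U'\<close>.\<close>

definition cascade_meet ::
  "(real \<Rightarrow> real \<Rightarrow> 'x::metric_space \<Rightarrow> 'y::metric_space \<Rightarrow> 'x) \<Rightarrow> (real \<Rightarrow> 'y \<Rightarrow> 'y) \<Rightarrow>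
   'y set \<times> ('x, 'y) germ \<Rightarrow> 'y set \<times> ('x, 'y) germ \<Rightarrow> 'y set \<times> ('x, 'y) germ" where
  "cascade_meet \<phi> \<psi> = (\<lambda>(A, s) (B, s').
     (A \<inter> B,
      \<Union>(U, \<sigma>)\<in>s. \<Union>(U', \<sigma>')\<in>s'.
        germ_rel \<phi> \<psi> (A \<inter> B) `` {(U \<inter> U', \<lambda>y. att_meet (layer \<phi> y) (\<sigma> y) (\<sigma>' y))}))"

definition meet_subsemilattice ::
  "(real \<Rightarrow> real \<Rightarrow> 'x::metric_space \<Rightarrow> 'y::metric_space \<Rightarrow> 'x) \<Rightarrow> (real \<Rightarrow> 'y \<Rightarrow> 'y) \<Rightarrow>
   ('y set \<times> ('x, 'y) germ) set \<Rightarrow> bool" where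
  "meet_subsemilattice \<phi> \<psi> L \<longleftrightarrow>
     L \<subseteq> cascade \<phi> \<psi> \<and> (\<forall>u\<in>L. \<forall>v\<in>L. cascade_meet \<phi> \<psi> u v \<in> L)"


section \<open>Singular attracting neighborhoods\<close>

definition SANbhd ::
  "(real \<Rightarrow> real \<Rightarrow> 'x::metric_space \<Rightarrow> 'y::metric_space \<Rightarrow> 'x) \<Rightarrow> (real \<Rightarrow> 'y \<Rightarrow> 'y) \<Rightarrow>
   ('x \<times> 'y) set set" where
  "SANbhd \<phi> \<psi> =
     {K. \<not> attracting_nbhd (skew \<phi> \<psi> 0) K \<and>
         (\<exists>\<epsilon>\<^sub>K>0. \<forall>\<epsilon>. 0 < \<epsilon> \<and> \<epsilon> \<le> \<epsilon>\<^sub>K \<longrightarrow> attracting_nbhd (skew \<phi> \<psi> \<epsilon>) K)}"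

text \<open>\<open>associated \<phi> \<psi> u K\<close>: the set \<open>K\<close> is a possible outcome of the construction of \<open>K(u)\<close>,
  for some choice of a representative \<open>(U, \<sigma>)\<close> of the germ, of finitely many base points \<open>p i\<close>, and of
  the sets \<open>V i\<close>, \<open>N i\<close>, the times \<open>T i\<close> and the block \<open>W\<close>.\<close>

definition associated ::
  "(real \<Rightarrow> real \<Rightarrow> 'x::metric_space \<Rightarrow> 'y::metric_space \<Rightarrow> 'x) \<Rightarrow> (real \<Rightarrow> 'y \<Rightarrow> 'y) \<Rightarrow>
   'y set \<times> ('x, 'y) germ \<Rightarrow> ('x \<times> 'y) set \<Rightarrow> bool" where
  "associated \<phi> \<psi> u K \<longleftrightarrow>
     (\<exists>U \<sigma> (n::nat) p V N (T :: nat \<Rightarrow> real) W.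
        (U, \<sigma>) \<in> snd u \<and>
        (\<forall>i<n. p i \<in> fst u \<and> open (V i) \<and> p i \<in> V i \<and> closure (V i) \<subseteq> U) \<and>
        fst u \<subseteq> (\<Union>i<n. V i) \<and>
        (\<forall>i<n. compact (N i) \<and> T i > 0 \<and>
           (\<forall>y'\<in>closure (V i).
              (\<forall>t\<ge>T i. layer \<phi> y' t ` N i \<subseteq> interior (N i)) \<and>
              omega (layer \<phi> y') (N i) = \<sigma> y')) \<and>
        compact W \<and> attracting_block \<psi> W \<and> W \<subseteq> (\<Union>i<n. V i) \<and>
        omega \<psi> W = fst u \<and> W = closure (interior W) \<and>
        K = closure (\<Union>i<n. N i \<times> (V i \<inter> interior W)))"


section \<open>The attractors carried by the generated lattice of neighborhoods\<close>

definition h_eps ::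
  "(real \<Rightarrow> real \<Rightarrow> 'x::metric_space \<Rightarrow> 'y::metric_space \<Rightarrow> 'x) \<Rightarrow> (real \<Rightarrow> 'y \<Rightarrow> 'y) \<Rightarrow>
   ('u \<Rightarrow> ('x \<times> 'y) set) \<Rightarrow> real \<Rightarrow> 'u \<Rightarrow> ('x \<times> 'y) set" where
  "h_eps \<phi> \<psi> K \<epsilon> u = Inv (skew \<phi> \<psi> \<epsilon>) (K u)"

definition A_eps ::
  "(real \<Rightarrow> real \<Rightarrow> 'x::metric_space \<Rightarrow> 'y::metric_space \<Rightarrow> 'x) \<Rightarrow> (real \<Rightarrow> 'y \<Rightarrow> 'y) \<Rightarrow>
   ('u \<Rightarrow> ('x \<times> 'y) set) \<Rightarrow> 'u set \<Rightarrow> real \<Rightarrow> ('x \<times> 'y) set set" where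
  "A_eps \<phi> \<psi> K L \<epsilon> = {Inv (skew \<phi> \<psi> \<epsilon>) N | N. N \<in> set_generated (K ` L)}"

end

theory Submission
  imports Defs
begin

text \<open>
  A lattice homomorphism carries the sublattice generated by a set onto the sublattice generated by
  the image of that set. For a semiflow on a compact space the attracting neighborhoods form
  a bounded lattice of sets under intersection and union, and \<^term>\<open>Inv \<theta>\<close> is a homomorphism from it
  to the lattice of attractors (\<open>attracting_nbhd_lattice\<close>, \<open>Inv_union\<close>, \<open>Inv_inter\<close>). At a parameter
  \<open>\<epsilon>\<close> not exceeding any threshold each \<open>K u\<close> is an attracting neighborhood, so the image under
  \<^term>\<open>Inv\<close> of the lattice generated by the sets \<open>K u\<close> is the lattice generated by their
  invariant sets.

  The homomorphism property rests on \<open>Inv_eq_omega\<close>: on an attracting neighborhood the maximal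
  invariant set is the omega-limit set, which is an attractor. Joins are then preserved because
  omega-limit sets of finite unions split, and meets because an invariant set lying in both of two
  sets lies in their intersection. Compactness enters through the invariance of omega-limit
  sets, where preimages along the semiflow have to be produced.
\<close>

section \<open>Omega-limit sets on compact spaces\<close>

lemma semiflow_continuous:
  assumes "semiflow \<theta>" "t \<ge> 0"
  shows "continuous_on S (\<theta> t)"
proof -
  have "continuous_on UNIV (\<lambda>z. (\<lambda>(t, z). \<theta> t z) (t, z))"
    by (rule continuous_on_compose2[of "{0..} \<times> UNIV"])
      (use assms in \<open>auto simp: semiflow_def intro!: continuous_intros\<close>)
  then show ?thesis by (auto intro: continuous_on_subset)
qed

lemma semiflow_tail_image:
  assumes "semiflow \<theta>" "t \<ge> 0" "s \<ge> 0"
  shows "\<theta> t ` (\<Union>r\<in>{s..}. \<theta> r ` U) = (\<Union>r\<in>{s + t..}. \<theta> r ` U)" (is "_ ` ?A = ?B")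
proof
  have add: "\<theta> t (\<theta> r z) = \<theta> (t + r) z" if "r \<ge> 0" for r z
    using assms that by (simp add: semiflow_def)
  show "\<theta> t ` ?A \<subseteq> ?B"
  proof
    fix y assume "y \<in> \<theta> t ` ?A"
    then obtain r z where "r \<ge> s" "z \<in> U" "y = \<theta> t (\<theta> r z)" by auto
    then show "y \<in> ?B" using add[of r z] assms(3) by (intro UN_I[of "t + r"]) auto
  qed
  show "?B \<subseteq> \<theta> t ` ?A"
  proof
    fix y assume "y \<in> ?B"
    then obtain r z where r: "r \<ge> s + t" "z \<in> U" "y = \<theta> r z" by auto
    then have "y = \<theta> t (\<theta> (r - t) z)" using add[of "r - t" z] assms(3) by simp
    moreover have "\<theta> (r - t) z \<in> ?A" using r by (intro UN_I[of "r - t"]) auto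
    ultimately show "y \<in> \<theta> t ` ?A" by blast
  qed
qed

lemma omega_mono: "U \<subseteq> V \<Longrightarrow> omega \<theta> U \<subseteq> omega \<theta> V"
  unfolding omega_def by (intro INT_anti_mono closure_mono UN_mono image_mono order_refl)

text \<open>The tails of a union are the unions of the tails, and the closures of tails decrease in time:
  a point that leaves both families has left both at the later of the two times.\<close>

lemma omega_union: "omega \<theta> (U \<union> V) = omega \<theta> U \<union> omega \<theta> V"
proof
  show "omega \<theta> U \<union> omega \<theta> V \<subseteq> omega \<theta> (U \<union> V)"
    by (simp add: omega_mono)
  let ?c = "\<lambda>t U. closure (\<Union>s\<in>{t..}. \<theta> s ` U)"
  have dec: "?c t W \<subseteq> ?c s W" if "s \<le> t" for s t W
    by (intro closure_mono UN_mono) (use that in auto)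
  have un: "?c t (U \<union> V) = ?c t U \<union> ?c t V" for t
    by (simp add: image_Un UN_Un_distrib)
  show "omega \<theta> (U \<union> V) \<subseteq> omega \<theta> U \<union> omega \<theta> V"
  proof (rule ccontr)
    assume "\<not> ?thesis"
    then obtain x s t where "x \<in> omega \<theta> (U \<union> V)" and st: "s \<ge> 0" "t \<ge> 0" "x \<notin> ?c s U" "x \<notin> ?c t V"
      unfolding omega_def by auto
    then have "x \<in> ?c (max s t) (U \<union> V)" unfolding omega_def by auto
    then show False using un dec[of s "max s t" U] dec[of t "max s t" V] st by auto
  qed
qed

text \<open>The inclusion of the image in the limit set is continuity. For the converse,
  a point \<open>x\<close> of the limit set has, in each closed tail, a preimage under \<open>\<theta> t\<close>;
  these sets of preimages are nested, nonempty and closed, so by compactness they have a common point.\<close>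

lemma omega_invariant:
  fixes \<theta> :: "real \<Rightarrow> 'z::metric_space \<Rightarrow> 'z"
  assumes sf: "semiflow \<theta>" and cpt: "compact (UNIV :: 'z set)"
  shows "invariant \<theta> (omega \<theta> U)"
  unfolding invariant_def
proof (intro allI impI)
  fix t :: real assume t: "t \<ge> 0"
  define B where "B s = closure (\<Union>r\<in>{s..}. \<theta> r ` U)" for s
  have om: "omega \<theta> U = (\<Inter>s\<in>{0..}. B s)" by (simp add: omega_def B_def)
  have dec: "B r \<subseteq> B s" if "s \<le> r" for s r
    unfolding B_def by (intro closure_mono UN_mono) (use that in auto)
  have compactB: "compact (B s)" for s
    using compact_Int_closed[OF cpt, of "B s"] by (simp add: B_def)
  have contB: "continuous_on (B s) (\<theta> t)" for s
    by (rule semiflow_continuous[OF sf t])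
  have step: "\<theta> t ` B s = B (s + t)" if "s \<ge> 0" for s
  proof
    show "\<theta> t ` B s \<subseteq> B (s + t)"
      using contB[of s] semiflow_tail_image[OF sf t that, of U] unfolding B_def
      by (intro image_closure_subset) (simp_all add: closure_subset)
    have "closed (\<theta> t ` B s)"
      by (intro compact_imp_closed compact_continuous_image contB compactB)
    moreover have "(\<Union>r\<in>{s + t..}. \<theta> r ` U) \<subseteq> \<theta> t ` B s"
      unfolding semiflow_tail_image[OF sf t that, symmetric] B_def
      by (intro image_mono closure_subset)
    ultimately show "B (s + t) \<subseteq> \<theta> t ` B s"
      unfolding B_def[of "s + t"] by (rule closure_minimal[rotated])
  qed
  show "\<theta> t ` omega \<theta> U = omega \<theta> U"
  proof
    show "\<theta> t ` omega \<theta> U \<subseteq> omega \<theta> U"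
    proof
      fix y assume "y \<in> \<theta> t ` omega \<theta> U"
      then have "y \<in> B (s + t)" if "s \<ge> 0" for s using step[OF that] that unfolding om by auto
      then have "y \<in> B s" if "s \<ge> 0" for s using dec[of s "s + t"] t that by auto
      then show "y \<in> omega \<theta> U" unfolding om by simp
    qed
    show "omega \<theta> U \<subseteq> \<theta> t ` omega \<theta> U"
    proof
      fix x assume x: "x \<in> omega \<theta> U"
      define P where "P s = B s \<inter> \<theta> t -` {x}" for s
      have "closed (\<theta> t -` {x})"
        by (intro closed_vimage closed_singleton semiflow_continuous[OF sf t])
      then have closedP: "closed (P s)" for s
        unfolding P_def B_def by (intro closed_Int closed_closure)
      have "UNIV \<inter> (\<Inter>s\<in>{0..}. P s) \<noteq> {}"
      proof (rule compact_imp_fip_image[OF cpt closedP])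
        fix I :: "real set" assume I: "finite I" "I \<subseteq> {0..}"
        define r where "r = Max (insert 0 I)"
        have r: "s \<le> r" if "s \<in> I" for s using I(1) that by (simp add: r_def)
        have r0: "r \<ge> 0" using I(1) by (simp add: r_def)
        have "x \<in> \<theta> t ` B r" using x t r0 step[of r] unfolding om by simp
        then have "P r \<noteq> {}" unfolding P_def by blast
        moreover have "P r \<subseteq> (\<Inter>s\<in>I. P s)" using dec[OF r] unfolding P_def by blast
        ultimately show "UNIV \<inter> (\<Inter>s\<in>I. P s) \<noteq> {}" by blast
      qed
      then obtain z where "\<And>s. s \<ge> 0 \<Longrightarrow> z \<in> P s" by auto
      then have "z \<in> omega \<theta> U" "\<theta> t z = x" unfolding om P_def by auto
      then show "x \<in> \<theta> t ` omega \<theta> U" by blast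
    qed
  qed
qed

section \<open>Attracting neighborhoods and their attractors\<close>

lemma invariant_subset_omega:
  assumes "invariant \<theta> S" "S \<subseteq> U"
  shows "S \<subseteq> omega \<theta> U"
proof -
  have "S \<subseteq> closure (\<Union>s\<in>{t..}. \<theta> s ` U)" if "t \<ge> 0" for t
  proof -
    have "S = \<theta> t ` S" using assms(1) that by (simp add: invariant_def)
    also have "\<dots> \<subseteq> (\<Union>s\<in>{t..}. \<theta> s ` U)" using assms(2) by auto
    finally show ?thesis using closure_subset by blast
  qed
  then show ?thesis unfolding omega_def by blast
qed

text \<open>The limit set lies in the closure of \<open>U\<close>; being its own image at
  a time when the closure has entered the interior, it lies in \<open>U\<close>.\<close>

lemma omega_subset_attracting_nbhd:
  fixes \<theta> :: "real \<Rightarrow> 'z::metric_space \<Rightarrow> 'z"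
  assumes "semiflow \<theta>" "compact (UNIV :: 'z set)" "attracting_nbhd \<theta> U"
  shows "omega \<theta> U \<subseteq> U"
proof -
  obtain \<tau> where \<tau>: "\<tau> > 0" "\<And>t. t \<ge> \<tau> \<Longrightarrow> \<theta> t ` closure U \<subseteq> interior U"
    using assms(3) unfolding attracting_nbhd_def by blast
  have "\<theta> s ` U \<subseteq> U" if "s \<ge> \<tau>" for s
    using \<tau>(2)[OF that] closure_subset[of U] interior_subset[of U] by blast
  then have "(\<Union>s\<in>{\<tau>..}. \<theta> s ` U) \<subseteq> U" by auto
  then have "closure (\<Union>s\<in>{\<tau>..}. \<theta> s ` U) \<subseteq> closure U" by (rule closure_mono)
  moreover have "omega \<theta> U \<subseteq> closure (\<Union>s\<in>{\<tau>..}. \<theta> s ` U)"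
    unfolding omega_def using \<tau>(1) by (intro INT_lower) simp
  ultimately have "\<theta> \<tau> ` omega \<theta> U \<subseteq> interior U" using \<tau>(2)[of \<tau>] by blast
  moreover have "\<theta> \<tau> ` omega \<theta> U = omega \<theta> U"
    using omega_invariant[OF assms(1,2), of U] \<tau>(1) by (simp add: invariant_def)
  ultimately show ?thesis using interior_subset by blast
qed

lemma Inv_eq_omega:
  fixes \<theta> :: "real \<Rightarrow> 'z::metric_space \<Rightarrow> 'z"
  assumes "semiflow \<theta>" "compact (UNIV :: 'z set)" "attracting_nbhd \<theta> U"
  shows "Inv \<theta> U = omega \<theta> U"
proof
  show "Inv \<theta> U \<subseteq> omega \<theta> U"
    unfolding Inv_def using invariant_subset_omega[of \<theta> _ U] by blast
  show "omega \<theta> U \<subseteq> Inv \<theta> U"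
    unfolding Inv_def using omega_invariant[OF assms(1,2)] omega_subset_attracting_nbhd[OF assms]
    by blast
qed

lemma attracting_nbhd_union:
  assumes "attracting_nbhd \<theta> U" "attracting_nbhd \<theta> V"
  shows "attracting_nbhd \<theta> (U \<union> V)"
proof -
  obtain s where s: "s > 0" "\<And>t. t \<ge> s \<Longrightarrow> \<theta> t ` closure U \<subseteq> interior U"
    using assms(1) unfolding attracting_nbhd_def by blast
  obtain r where r: "r > 0" "\<And>t. t \<ge> r \<Longrightarrow> \<theta> t ` closure V \<subseteq> interior V"
    using assms(2) unfolding attracting_nbhd_def by blast
  have "\<theta> t ` closure (U \<union> V) \<subseteq> interior (U \<union> V)" if "t \<ge> max s r" for t
    using s(2)[of t] r(2)[of t] that interior_mono[of U "U \<union> V"] interior_mono[of V "U \<union> V"]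
    by (simp add: image_Un) blast
  then show ?thesis unfolding attracting_nbhd_def using s(1) by (intro exI[of _ "max s r"]) auto
qed

lemma attracting_nbhd_inter:
  assumes "attracting_nbhd \<theta> U" "attracting_nbhd \<theta> V"
  shows "attracting_nbhd \<theta> (U \<inter> V)"
proof -
  obtain s where s: "s > 0" "\<And>t. t \<ge> s \<Longrightarrow> \<theta> t ` closure U \<subseteq> interior U"
    using assms(1) unfolding attracting_nbhd_def by blast
  obtain r where r: "r > 0" "\<And>t. t \<ge> r \<Longrightarrow> \<theta> t ` closure V \<subseteq> interior V"
    using assms(2) unfolding attracting_nbhd_def by blast
  have "\<theta> t ` closure (U \<inter> V) \<subseteq> interior (U \<inter> V)" if "t \<ge> max s r" for t
    using s(2)[of t] r(2)[of t] that closure_mono[of "U \<inter> V" U] closure_mono[of "U \<inter> V" V]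
    by (simp add: interior_Int) blast
  then show ?thesis unfolding attracting_nbhd_def using s(1) by (intro exI[of _ "max s r"]) auto
qed

lemma attracting_nbhd_lattice:
  "bounded_sublattice UNIV {} UNIV (\<inter>) (\<union>) (Collect (attracting_nbhd \<theta>))"
proof -
  have "attracting_nbhd \<theta> {}" "attracting_nbhd \<theta> UNIV"
    unfolding attracting_nbhd_def by (auto intro: exI[of _ 1])
  then show ?thesis
    by (simp add: bounded_sublattice_def attracting_nbhd_inter attracting_nbhd_union)
qed

lemma Inv_in_Att:
  fixes \<theta> :: "real \<Rightarrow> 'z::metric_space \<Rightarrow> 'z"
  assumes "semiflow \<theta>" "compact (UNIV :: 'z set)" "attracting_nbhd \<theta> U"
  shows "Inv \<theta> U \<in> Att \<theta>"
  using Inv_eq_omega[OF assms] assms(3) unfolding Att_def by blast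

lemma Inv_union:
  fixes \<theta> :: "real \<Rightarrow> 'z::metric_space \<Rightarrow> 'z"
  assumes "semiflow \<theta>" "compact (UNIV :: 'z set)" "attracting_nbhd \<theta> U" "attracting_nbhd \<theta> V"
  shows "Inv \<theta> (U \<union> V) = Inv \<theta> U \<union> Inv \<theta> V"
  using assms by (simp add: Inv_eq_omega attracting_nbhd_union omega_union)

text \<open>The intersection of two attractors need not be invariant, which is why the meet takes its
  limit set. That limit set is squeezed: it contains every invariant subset of
  both neighborhoods, and by monotonicity it lies in the limit set of their intersection.\<close>

lemma Inv_inter:
  fixes \<theta> :: "real \<Rightarrow> 'z::metric_space \<Rightarrow> 'z"
  assumes "semiflow \<theta>" "compact (UNIV :: 'z set)" "attracting_nbhd \<theta> U" "attracting_nbhd \<theta> V"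
  shows "Inv \<theta> (U \<inter> V) = att_meet \<theta> (Inv \<theta> U) (Inv \<theta> V)"
proof -
  note eq = Inv_eq_omega[OF assms(1,2)]
  have "omega \<theta> (U \<inter> V) \<subseteq> omega \<theta> (omega \<theta> U \<inter> omega \<theta> V)"
    by (intro invariant_subset_omega omega_invariant assms(1,2) Int_greatest omega_mono) auto
  moreover have "omega \<theta> (omega \<theta> U \<inter> omega \<theta> V) \<subseteq> omega \<theta> (U \<inter> V)"
    by (intro omega_mono Int_mono omega_subset_attracting_nbhd assms)
  ultimately show ?thesis
    using assms by (simp add: eq attracting_nbhd_inter att_meet_def)
qed

text \<open>Intersection distributes over union, and limit sets split over unions.\<close>

lemma att_meet_distrib:
  "att_meet \<theta> a (b \<union> c) = att_meet \<theta> a b \<union> att_meet \<theta> a c"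
  by (simp add: att_meet_def Int_Un_distrib omega_union)

section \<open>Generated sublattices\<close>

text \<open>The preimage under the homomorphism of a sublattice containing \<open>f ` S\<close> is a sublattice
  containing \<open>S\<close>, and the image of the sublattice generated by \<open>S\<close> is one containing \<open>f ` S\<close>; each
  inclusion is one of these facts together with minimality. The operations are respected on a sublattice \<open>D\<close>
  containing the generators, because \<^term>\<open>Inv \<theta>\<close> is a homomorphism on attracting
  neighborhoods and not on all sets.\<close>

lemma image_generated_sublattice:
  assumes D: "bounded_sublattice C l g m j D" and S: "S \<subseteq> D"
    and maps: "f ` D \<subseteq> C'" and least: "f l = l'" and greatest: "f g = g'"
    and meet: "\<And>a b. a \<in> D \<Longrightarrow> b \<in> D \<Longrightarrow> f (m a b) = m' (f a) (f b)"
    and join: "\<And>a b. a \<in> D \<Longrightarrow> b \<in> D \<Longrightarrow> f (j a b) = j' (f a) (f b)"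
  shows "bounded_sublattice C' l' g' m' j' (f ` generated_sublattice C l g m j S)"
    and "f ` generated_sublattice C l g m j S = generated_sublattice C' l' g' m' j' (f ` S)"
proof -
  let ?G = "generated_sublattice C l g m j S"
  have GD: "?G \<subseteq> D" using D S by (rule generated_sublattice_least)
  have SG: "S \<subseteq> ?G" by (auto simp: generated_sublattice_def)
  have G: "l \<in> ?G" "g \<in> ?G" "\<And>a b. a \<in> ?G \<Longrightarrow> b \<in> ?G \<Longrightarrow> m a b \<in> ?G \<and> j a b \<in> ?G"
    by (auto simp: generated_sublattice_def bounded_sublattice_def)
  show sub: "bounded_sublattice C' l' g' m' j' (f ` ?G)"
    unfolding bounded_sublattice_def
  proof (intro conjI ballI)
    show "f ` ?G \<subseteq> C'" using GD maps by blast
    show "l' \<in> f ` ?G" "g' \<in> f ` ?G" using G(1,2) least greatest by blast+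
    fix x y assume "x \<in> f ` ?G" "y \<in> f ` ?G"
    then obtain a b where ab: "a \<in> ?G" "b \<in> ?G" "x = f a" "y = f b" by blast
    have "a \<in> D" "b \<in> D" using ab(1,2) GD by auto
    then have "m' x y = f (m a b)" "j' x y = f (j a b)" using meet[of a b] join[of a b] ab(3,4) by auto
    then show "m' x y \<in> f ` ?G" "j' x y \<in> f ` ?G" using G(3)[OF ab(1,2)] by auto
  qed
  have "?G \<subseteq> {a \<in> D. f a \<in> M}" if M: "bounded_sublattice C' l' g' m' j' M" "f ` S \<subseteq> M" for M
  proof (rule generated_sublattice_least)
    show "bounded_sublattice C l g m j {a \<in> D. f a \<in> M}"
      using D M(1) least greatest meet join by (auto simp: bounded_sublattice_def)
    show "S \<subseteq> {a \<in> D. f a \<in> M}" using S M(2) by blast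
  qed
  then have "f ` ?G \<subseteq> generated_sublattice C' l' g' m' j' (f ` S)"
    unfolding generated_sublattice_def[of C'] by blast
  moreover have "generated_sublattice C' l' g' m' j' (f ` S) \<subseteq> f ` ?G"
    using sub SG by (intro generated_sublattice_least image_mono)
  ultimately show "f ` ?G = generated_sublattice C' l' g' m' j' (f ` S)" by (rule equalityI)
qed

lemma finite_set_generated:
  assumes "finite L"
  shows "finite (set_generated (K ` L))"
proof -
  have "set_generated (K ` L) \<subseteq> (\<lambda>\<T>. \<Union>T\<in>\<T>. \<Inter>u\<in>T. K u) ` Pow (Pow L)"
    unfolding set_generated_family by blast
  then show ?thesis by (rule finite_subset) (simp add: assms)
qed

text \<open>The generation principle applied to \<^term>\<open>Inv \<theta>\<close>, with the attracting neighborhoods as the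
  sublattice of the powerset on which it is a homomorphism.\<close>

lemma Inv_image_set_generated:
  fixes \<theta> :: "real \<Rightarrow> 'z::metric_space \<Rightarrow> 'z"
  assumes "semiflow \<theta>" "compact (UNIV :: 'z set)" "\<And>N. N \<in> S \<Longrightarrow> attracting_nbhd \<theta> N"
  shows "att_sublattice \<theta> (Inv \<theta> ` set_generated S)"
    and "Inv \<theta> ` set_generated S = att_generated \<theta> (Inv \<theta> ` S)"
proof -
  have "Inv \<theta> UNIV = omega \<theta> UNIV" "Inv \<theta> {} = {}"
    using Inv_eq_omega[OF assms(1,2), of UNIV] attracting_nbhd_lattice[of \<theta>]
    by (auto simp: bounded_sublattice_def Inv_def)
  note hom = this Inv_inter[OF assms(1,2)] Inv_union[OF assms(1,2)] Inv_in_Att[OF assms(1,2)]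
  show "att_sublattice \<theta> (Inv \<theta> ` set_generated S)"
    unfolding att_sublattice_def set_generated_def
    by (rule image_generated_sublattice(1)[OF attracting_nbhd_lattice[of \<theta>]])
      (use assms(3) hom in auto)
  show "Inv \<theta> ` set_generated S = att_generated \<theta> (Inv \<theta> ` S)"
    unfolding att_generated_def set_generated_def
    by (rule image_generated_sublattice(2)[OF attracting_nbhd_lattice[of \<theta>]])
      (use assms(3) hom in auto)
qed

section \<open>The attractor lattice of a fast-slow system\<close>

theorem theorem5p26:
  fixes \<phi> :: "real \<Rightarrow> real \<Rightarrow> 'x::metric_space \<Rightarrow> 'y::metric_space \<Rightarrow> 'x"
    and \<psi> :: "real \<Rightarrow> 'y \<Rightarrow> 'y"
    and L :: "('y set \<times> ('x, 'y) germ) set"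
    and K :: "'y set \<times> ('x, 'y) germ \<Rightarrow> ('x \<times> 'y) set"
    and \<epsilon>\<^sub>1 :: "'y set \<times> ('x, 'y) germ \<Rightarrow> real"
  assumes "fast_slow \<phi> \<psi>"
    and "finite L" and "L \<noteq> {}" and "meet_subsemilattice \<phi> \<psi> L"
    and "\<And>u. u \<in> L \<Longrightarrow> K u \<in> SANbhd \<phi> \<psi> \<and> associated \<phi> \<psi> u (K u)"
    and "\<And>u. u \<in> L \<Longrightarrow> \<epsilon>\<^sub>1 u > 0 \<and>
           (\<forall>\<epsilon>. 0 < \<epsilon> \<and> \<epsilon> \<le> \<epsilon>\<^sub>1 u \<longrightarrow> attracting_nbhd (skew \<phi> \<psi> \<epsilon>) (K u))"
  shows "\<forall>\<epsilon>. 0 < \<epsilon> \<and> \<epsilon> \<le> Min (\<epsilon>\<^sub>1 ` L) \<longrightarrow>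
           A_eps \<phi> \<psi> K L \<epsilon> = att_generated (skew \<phi> \<psi> \<epsilon>) (h_eps \<phi> \<psi> K \<epsilon> ` L) \<and>
           A_eps \<phi> \<psi> K L \<epsilon> \<subseteq> Att (skew \<phi> \<psi> \<epsilon>) \<and>
           finite (A_eps \<phi> \<psi> K L \<epsilon>) \<and>
           att_sublattice (skew \<phi> \<psi> \<epsilon>) (A_eps \<phi> \<psi> K L \<epsilon>) \<and>
           (\<forall>a\<in>A_eps \<phi> \<psi> K L \<epsilon>. \<forall>b\<in>A_eps \<phi> \<psi> K L \<epsilon>. \<forall>c\<in>A_eps \<phi> \<psi> K L \<epsilon>.
              att_meet (skew \<phi> \<psi> \<epsilon>) a (b \<union> c) =
              att_meet (skew \<phi> \<psi> \<epsilon>) a b \<union> att_meet (skew \<phi> \<psi> \<epsilon>) a c)"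
proof (intro allI impI, elim conjE)
  fix \<epsilon> assume \<epsilon>: "0 < \<epsilon>" "\<epsilon> \<le> Min (\<epsilon>\<^sub>1 ` L)"
  let ?\<theta> = "skew \<phi> \<psi> \<epsilon>"
  have sf: "semiflow ?\<theta>" using assms(1) \<epsilon>(1) by (simp add: fast_slow_def)
  have "compact ((UNIV :: 'x set) \<times> (UNIV :: 'y set))"
    using assms(1) by (intro compact_Times) (simp_all add: fast_slow_def)
  then have cpt: "compact (UNIV :: ('x \<times> 'y) set)" by simp
  have "attracting_nbhd ?\<theta> (K u)" if "u \<in> L" for u
  proof -
    have "Min (\<epsilon>\<^sub>1 ` L) \<le> \<epsilon>\<^sub>1 u" using assms(2) that by simp
    then show ?thesis using assms(6)[OF that] \<epsilon> by auto
  qed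
  then have nb: "\<And>N. N \<in> K ` L \<Longrightarrow> attracting_nbhd ?\<theta> N" by blast
  have A: "A_eps \<phi> \<psi> K L \<epsilon> = Inv ?\<theta> ` set_generated (K ` L)"
    unfolding A_eps_def by blast
  have h: "h_eps \<phi> \<psi> K \<epsilon> ` L = Inv ?\<theta> ` K ` L"
    by (simp add: h_eps_def image_image)
  note gen = Inv_image_set_generated[OF sf cpt nb]
  show "A_eps \<phi> \<psi> K L \<epsilon> = att_generated ?\<theta> (h_eps \<phi> \<psi> K \<epsilon> ` L) \<and>
    A_eps \<phi> \<psi> K L \<epsilon> \<subseteq> Att ?\<theta> \<and> finite (A_eps \<phi> \<psi> K L \<epsilon>) \<and> att_sublattice ?\<theta> (A_eps \<phi> \<psi> K L \<epsilon>) \<and>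
    (\<forall>a\<in>A_eps \<phi> \<psi> K L \<epsilon>. \<forall>b\<in>A_eps \<phi> \<psi> K L \<epsilon>. \<forall>c\<in>A_eps \<phi> \<psi> K L \<epsilon>.
      att_meet ?\<theta> a (b \<union> c) = att_meet ?\<theta> a b \<union> att_meet ?\<theta> a c)"
    unfolding A h
  proof (intro conjI ballI att_meet_distrib)
    show "Inv ?\<theta> ` set_generated (K ` L) \<subseteq> Att ?\<theta>"
      using gen(1) by (simp add: att_sublattice_def bounded_sublattice_def)
    show "finite (Inv ?\<theta> ` set_generated (K ` L))"
      using finite_set_generated[OF assms(2)] by (rule finite_imageI)
    show "Inv ?\<theta> ` set_generated (K ` L) = att_generated ?\<theta> (Inv ?\<theta> ` K ` L)"
      by (rule gen(2))
    show "att_sublattice ?\<theta> (Inv ?\<theta> ` set_generated (K ` L))"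
      by (rule gen(1))
  qed
qed

end
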